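(* Consider the linear-quadratic dynamic game with system matrices $A\in\mathbb{R}^{n\times n}$, $B_i\in\mathbb{R}^{n\times m}$, weights $Q_i,R_i$ ($i\in\mathcal I=\{1,\dots,N\}$), stabilizing coupled-Riccati solution $(P_i,K_i)_{i\in\mathcal I}$, horizon $T\in\mathbb{N}$, $T\ge 1$, finite-horizon feasible set $\mathcal U_T(x_0)$, matrix $M$, vector $q=q(x_0)$, and terminal set $\mathbb X_f$, all as specified in the context. Let $x_0\in\mathbb{X}_f$ and suppose that $M+M^{\top}\succ 0$. For all $i\in\mathcal I$ and all $t$, let $$u_i^*[t]=K_i\Big(A+\sum_{j\in\mathcal I}B_jK_j\Big)^t x_0 .$$ Then the unique solution of the affine variational inequality $$\text{find } \boldsymbol u\in\mathcal U_T(x_0)\ \text{ such that }\ \langle M\boldsymbol u+q,\ \boldsymbol v-\boldsymbol u\rangle\ge 0\quad\text{for all } \boldsymbol v\in\mathcal U_T(x_0)$$ is the truncated sequence $\boldsymbol u^*[0],\dots,\boldsymbol u^*[T-1]$, i.e. the vector obtained by stacking over $i\in\mathcal I$ the vectors $(u_i^*[0],\dots,u_i^*[T-1])$.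
   Context: **Dynamics and costs.** There are $N$ agents, indexed by $\mathcal I=\{1,\dots,N\}$. The state $x[t]\in\mathbb R^n$ evolves as $x[t+1]=Ax[t]+\sum_{i\in\mathcal I}B_iu_i[t]$, where $u_i[t]\in\mathbb R^m$ is the input of agent $i$. $\phi(t,x_0,\boldsymbol u)$ denotes the state at time $t$ starting from $x[0]=x_0$ under the collective input sequence $\boldsymbol u=(u_i)_{i\in\mathcal I}$. The stage cost of agent $i$ is $\tfrac12 x^\top Q_ix+\tfrac12u_i^\top R_iu_i$ with $Q_i=C_i^\top C_i\succeq0$ and $R_i=R_i^\top\succ0$; for every $i$, $(A,B_i)$ is stabilizable and $(A,C_i)$ is detectable. **Constraints.** Given matrices $D^{\rm x},D^{\rm u}_j$ and vectors $d^{\rm x},d^{\rm u}$, with inequalities understood componentwise, let $\mathbb X=\{x: D^{\rm x}x+d^{\rm x}\le0\}$ and $\mathbb U_i(\boldsymbol u_{-i}[t])=\{u_i[t]:\sum_{j\in\mathcal I}D^{\rm u}_ju_j[t]+d^{\rm u}\le0\}$, where $\boldsymbol u_{-i}$ collects the inputs of all agents other than $i$. It is assumed that $0\in\mathrm{int}(\mathbb X)$ and $0\in\mathrm{int}(\mathbb U_i(0))$ for all $i$. For a positive integer $T$, $$\mathcal U_T(x_0)=\{\boldsymbol u:\ u_i[t]\in\mathbb U_i(\boldsymbol u_{-i}[t])\ \forall i\in\mathcal I,\ 0\le t<T;\ \ \phi(t,x_0,\boldsymbol u)\in\mathbb X\ \forall\, 0\le t<T\}.$$ Length-$T$ input sequences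 are identified with vectors: $u_i=(u_i[0];\dots;u_i[T-1])\in\mathbb R^{mT}$ and $\boldsymbol u=(u_1;\dots;u_N)\in\mathbb R^{NmT}$ (column stacking). **Standing assumption on $A$.** $A$ is invertible; with $A^{-\top}=(A^\top)^{-1}$ and $S_i=B_iR_i^{-1}B_i^\top$, the matrix $$H=\begin{bmatrix}A+\sum_{j\in\mathcal I}S_jA^{-\top}Q_j & \big[-S_1A^{-\top}\ \cdots\ -S_NA^{-\top}\big]\\ \begin{bmatrix}-A^{-\top}Q_1\\ \vdots\\ -A^{-\top}Q_N\end{bmatrix} & I_N\otimes A^{-\top}\end{bmatrix}$$ has exactly $n$ eigenvalues of modulus strictly less than $1$, and an $n$-dimensional invariant subspace of $H$ is complementary to the image of $\begin{bmatrix}0_{n\times Nn}\\ I_{Nn}\end{bmatrix}$. **Coupled Riccati equations.** $(P_i,K_i)_{i\in\mathcal I}$, with $P_i\in\mathbb R^{n\times n}$ and $K_i\in\mathbb R^{m\times n}$, denotes the solution (which exists under the standing assumption) of $$P_i=Q_i+A^\top P_i\Big(A+\sum_{j\in\mathcal I}B_jK_j\Big),\qquad K_i=-R_i^{-1}B_i^\top P_i\Big(A+\sum_{j\in\mathcal I}B_jK_j\Big),\qquad i\in\mathcal I,$$ such that the gains $(K_i)_{i\in\mathcal I}$ stabilize the system, i.e. all eigenvalues of $A+\sum_jB_jK_j$ have modulus strictly less than $1$. **Terminal set.** $\mathbb X_f\subseteq\mathbb R^n$ is a forward-invariant, constraint-admissible set for the closed-loop dynamics $x[t+1]=(A+\sum_{j}B_jK_j)x[t]$: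 for every $x\in\mathbb X_f$ one has $(A+\sum_jB_jK_j)x\in\mathbb X_f$, $x\in\mathbb X$, and $\sum_{j\in\mathcal I}D^{\rm u}_jK_jx+d^{\rm u}\le0$. **VI data.** Let $\Theta$ and $(\Gamma_i)_{i\in\mathcal I}$ be the matrices for which the dynamics read $(x[1];\dots;x[T])=\Theta x_0+\sum_{i\in\mathcal I}\Gamma_iu_i$, i.e. $\Theta=(A;A^2;\dots;A^T)$ (column stack), and $\Gamma_i$ is the block matrix whose $(t,s)$ block, $1\le t,s\le T$, is $A^{t-s}B_i$ if $t\ge s$ and $0$ otherwise. Set $\bar R_i=I_T\otimes R_i$ and $\bar Q_i=\mathrm{blockdiag}(I_{T-1}\otimes Q_i,\,P_i)$. Then $$M=\mathrm{blockdiag}(\bar R_1,\dots,\bar R_N)+\big[\Gamma_i^\top\bar Q_i\Gamma_j\big]_{i,j\in\mathcal I},\qquad q=\big(\Gamma_1^\top\bar Q_1\Theta x_0;\dots;\Gamma_N^\top\bar Q_N\Theta x_0\big),$$ where $[\cdot]_{i,j}$ denotes the block matrix with the indicated $(i,j)$ block. $M$ need not be symmetric. *)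

theory Defs
  imports "HOL-Analysis.Analysis" "HOL-Computational_Algebra.Polynomial"
begin

section \<open>Matrices\<close>

text \<open>The power operator on \<^typ>\<open>real^'n^'n\<close> is entrywise, so powers with respect
  to the matrix product need their own operation.\<close>

primrec matpow :: "'a::semiring_1^'n^'n \<Rightarrow> nat \<Rightarrow> 'a^'n^'n" where
  "matpow A 0 = mat 1"
| "matpow A (Suc k) = A ** matpow A k"

definition pos_def :: "real^'n^'n \<Rightarrow> bool" where
  "pos_def M \<longleftrightarrow> transpose M = M \<and> (\<forall>x. x \<noteq> 0 \<longrightarrow> x \<bullet> (M *v x) > 0)"

definition eigval :: "real^'n^'n \<Rightarrow> complex \<Rightarrow> bool" where
  "eigval A z \<longleftrightarrow> (\<exists>v. v \<noteq> 0 \<and> map_matrix complex_of_real A *v v = z *s v)"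

definition charpoly :: "real^'n^'n \<Rightarrow> complex poly" where
  "charpoly A = det (mat [:0, 1:] - map_matrix (\<lambda>a. [:complex_of_real a:]) A)"

text \<open>The order of the root in the characteristic polynomial is the algebraic multiplicity.\<close>

definition num_stable_eigvals :: "real^'n^'n \<Rightarrow> nat" where
  "num_stable_eigvals A = (\<Sum>z | eigval A z \<and> cmod z < 1. order z (charpoly A))"

definition schur_stable :: "real^'n^'n \<Rightarrow> bool" where
  "schur_stable A \<longleftrightarrow> (\<forall>z. eigval A z \<longrightarrow> cmod z < 1)"

definition stabilizable :: "real^'n^'n \<Rightarrow> real^'m^'n \<Rightarrow> bool" where
  "stabilizable A B \<longleftrightarrow> (\<exists>F :: real^'n^'m. schur_stable (A + B ** F))"

definition detectable :: "real^'n^'n \<Rightarrow> real^'n^'p \<Rightarrow> bool" where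
  "detectable A C \<longleftrightarrow> (\<exists>L :: real^'p^'n. schur_stable (A + L ** C))"


section \<open>Dynamics and constraints\<close>

text \<open>Agents are the elements of a finite type \<^typ>\<open>'i\<close>; an input sequence
  \<open>u\<close> gives the input \<open>u i t\<close> of agent \<open>i\<close> at time \<open>t\<close>.\<close>

primrec state :: "real^'n^'n \<Rightarrow> ('i::finite \<Rightarrow> real^'m^'n) \<Rightarrow> nat \<Rightarrow> real^'n
    \<Rightarrow> ('i \<Rightarrow> nat \<Rightarrow> real^'m) \<Rightarrow> real^'n" where
  "state A B 0 x0 u = x0"
| "state A B (Suc t) x0 u = A *v state A B t x0 u + (\<Sum>i\<in>UNIV. B i *v u i t)"

text \<open>The order on vectors is the componentwise one.\<close>

definition state_constr :: "real^'n^'r \<Rightarrow> real^'r \<Rightarrow> (real^'n) set" where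
  "state_constr Dx dx = {x. Dx *v x + dx \<le> 0}"

text \<open>The inputs admissible for agent \<open>i\<close>, given the inputs of the others. The
  \<open>i\<close>-th entry of the profile \<open>w\<close> is irrelevant, as it is overwritten.\<close>

definition input_constr ::
  "('i::finite \<Rightarrow> real^'m^'s) \<Rightarrow> real^'s \<Rightarrow> 'i \<Rightarrow> ('i \<Rightarrow> real^'m) \<Rightarrow> (real^'m) set" where
  "input_constr Du du i w = {v. (\<Sum>j\<in>UNIV. Du j *v (w(i := v)) j) + du \<le> 0}"

definition feasible_inputs ::
  "real^'n^'n \<Rightarrow> ('i::finite \<Rightarrow> real^'m^'n) \<Rightarrow> real^'n^'r \<Rightarrow> real^'r
    \<Rightarrow> ('i \<Rightarrow> real^'m^'s) \<Rightarrow> real^'s \<Rightarrow> nat \<Rightarrow> real^'n \<Rightarrow> ('i \<Rightarrow> nat \<Rightarrow> real^'m) set" where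
  "feasible_inputs A B Dx dx Du du T x0 =
     {u. (\<forall>i. \<forall>t<T. u i t \<in> input_constr Du du i (\<lambda>j. u j t)) \<and>
         (\<forall>t<T. state A B t x0 u \<in> state_constr Dx dx)}"

definition closed_loop ::
  "real^'n^'n \<Rightarrow> ('i::finite \<Rightarrow> real^'m^'n) \<Rightarrow> ('i \<Rightarrow> real^'n^'m) \<Rightarrow> real^'n^'n" where
  "closed_loop A B K = A + (\<Sum>j\<in>UNIV. B j ** K j)"

definition terminal_set ::
  "real^'n^'n \<Rightarrow> ('i::finite \<Rightarrow> real^'m^'n) \<Rightarrow> ('i \<Rightarrow> real^'n^'m) \<Rightarrow> real^'n^'r \<Rightarrow> real^'r
    \<Rightarrow> ('i \<Rightarrow> real^'m^'s) \<Rightarrow> real^'s \<Rightarrow> (real^'n) set \<Rightarrow> bool" where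
  "terminal_set A B K Dx dx Du du Xf \<longleftrightarrow>
     (\<forall>x\<in>Xf. closed_loop A B K *v x \<in> Xf \<and> x \<in> state_constr Dx dx \<and>
       (\<Sum>j\<in>UNIV. Du j *v (K j *v x)) + du \<le> 0)"


section \<open>Coupled Riccati equations\<close>

definition coupled_riccati ::
  "real^'n^'n \<Rightarrow> ('i::finite \<Rightarrow> real^'m^'n) \<Rightarrow> ('i \<Rightarrow> real^'n^'n) \<Rightarrow> ('i \<Rightarrow> real^'m^'m)
    \<Rightarrow> ('i \<Rightarrow> real^'n^'n) \<Rightarrow> ('i \<Rightarrow> real^'n^'m) \<Rightarrow> bool" where
  "coupled_riccati A B Q R P K \<longleftrightarrow>
     (\<forall>i. P i = Q i + transpose A ** P i ** closed_loop A B K \<and>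
          K i = - (matrix_inv (R i) ** transpose (B i) ** P i ** closed_loop A B K))"

text \<open>The rows and columns of \<open>H\<close> are indexed by \<^typ>\<open>'n + 'i \<times> 'n\<close>:
  first the state block, then one block of size \<^typ>\<open>'n\<close> for each agent.\<close>

definition H_matrix ::
  "real^'n^'n \<Rightarrow> ('i::finite \<Rightarrow> real^'m^'n) \<Rightarrow> ('i \<Rightarrow> real^'n^'n) \<Rightarrow> ('i \<Rightarrow> real^'m^'m)
    \<Rightarrow> real^('n + 'i \<times> 'n)^('n::finite + 'i \<times> 'n)" where
  "H_matrix A B Q R =
    (let A' = matrix_inv (transpose A);
         S = (\<lambda>i. B i ** matrix_inv (R i) ** transpose (B i))
     in \<chi> r c. case (r, c) of
          (Inl k, Inl l) \<Rightarrow> (A + (\<Sum>j\<in>UNIV. S j ** A' ** Q j)) $ k $ l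
        | (Inl k, Inr (j, l)) \<Rightarrow> - (S j ** A') $ k $ l
        | (Inr (i, k), Inl l) \<Rightarrow> - (A' ** Q i) $ k $ l
        | (Inr (i, k), Inr (j, l)) \<Rightarrow> (if i = j then A' $ k $ l else 0))"

definition costate_embedding :: "real^('i::finite \<times> 'n::finite)^('n + 'i \<times> 'n)" where
  "costate_embedding = (\<chi> r c. case r of Inl k \<Rightarrow> 0 | Inr p \<Rightarrow> (if p = c then 1 else 0))"

definition complementary :: "'a::real_vector set \<Rightarrow> 'a set \<Rightarrow> bool" where
  "complementary V W \<longleftrightarrow> V \<inter> W = {0} \<and> {v + w | v w. v \<in> V \<and> w \<in> W} = UNIV"

definition H_condition ::
  "real^'n^'n \<Rightarrow> ('i::finite \<Rightarrow> real^'m^'n) \<Rightarrow> ('i \<Rightarrow> real^'n^'n) \<Rightarrow> ('i \<Rightarrow> real^'m^'m) \<Rightarrow> bool" where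
  "H_condition A B Q R \<longleftrightarrow>
     num_stable_eigvals (H_matrix A B Q R) = CARD('n) \<and>
     (\<exists>V. subspace V \<and> dim V = CARD('n) \<and> (\<forall>v\<in>V. H_matrix A B Q R *v v \<in> V) \<and>
          complementary V (range (\<lambda>y. costate_embedding *v y)))"


section \<open>The variational inequality\<close>

text \<open>The horizon is represented by a finite linearly ordered type \<^typ>\<open>'t\<close>, with
  \<open>CARD('t) = T\<close>; every positive \<open>T\<close> arises in this way, e.g. from a numeral
  type. The element at position \<open>k\<close> stands for time \<open>k\<close> in an input sequence
  (\<open>0 \<le> k < T\<close>), and for time \<open>k + 1\<close> in the stacked states
  \<open>(x[1]; \<dots>; x[T])\<close>, i.e. for the \<open>(k+1)\<close>-st block in a stack of \<open>T\<close> blocks.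
  Stacked vectors of dimension \<open>m T\<close>, \<open>N m T\<close> and \<open>n T\<close> are indexed by
  \<^typ>\<open>'t \<times> 'm\<close>, \<^typ>\<open>'i \<times> 't \<times> 'm\<close> and \<^typ>\<open>'t \<times> 'n\<close>.\<close>

definition pos :: "'t::{finite,linorder} \<Rightarrow> nat" where
  "pos t = card {s. s < t}"

text \<open>Identification of (the first \<open>T\<close> entries of) an input sequence with a vector.\<close>

definition stack :: "('i::finite \<Rightarrow> nat \<Rightarrow> real^'m) \<Rightarrow> real^('i \<times> 't::{finite,linorder} \<times> 'm::finite)" where
  "stack u = (\<chi> r. case r of (i, t, k) \<Rightarrow> u i (pos t) $ k)"

definition Theta :: "real^'n^'n \<Rightarrow> real^'n^('t::{finite,linorder} \<times> 'n::finite)" where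
  "Theta A = (\<chi> r l. case r of (t, k) \<Rightarrow> matpow A (pos t + 1) $ k $ l)"

definition Gamma ::
  "real^'n^'n \<Rightarrow> real^'m^'n \<Rightarrow> real^('t \<times> 'm)^('t::{finite,linorder} \<times> 'n::finite)" where
  "Gamma A B = (\<chi> r c. case (r, c) of ((t, k), (s, l)) \<Rightarrow>
     if s \<le> t then (matpow A (pos t - pos s) ** B) $ k $ l else 0)"

definition R_bar :: "real^'m^'m \<Rightarrow> real^('t \<times> 'm)^('t::{finite,linorder} \<times> 'm::finite)" where
  "R_bar R = (\<chi> r c. case (r, c) of ((t, k), (s, l)) \<Rightarrow> if t = s then R $ k $ l else 0)"

definition Q_bar :: "real^'n^'n \<Rightarrow> real^'n^'n \<Rightarrow> real^('t \<times> 'n)^('t::{finite,linorder} \<times> 'n::finite)" where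
  "Q_bar Q P = (\<chi> r c. case (r, c) of ((t, k), (s, l)) \<Rightarrow>
     if t = s then (if pos t + 1 = CARD('t) then P else Q) $ k $ l else 0)"

definition M_matrix ::
  "real^'n^'n \<Rightarrow> ('i::finite \<Rightarrow> real^'m^'n) \<Rightarrow> ('i \<Rightarrow> real^'n^'n) \<Rightarrow> ('i \<Rightarrow> real^'m^'m)
    \<Rightarrow> ('i \<Rightarrow> real^'n^'n) \<Rightarrow> real^('i \<times> 't \<times> 'm)^('i \<times> 't::{finite,linorder} \<times> 'm::finite)" where
  "M_matrix A B Q R P = (\<chi> r c. case (r, c) of ((i, a), (j, b)) \<Rightarrow>
     (if i = j then R_bar (R i) $ a $ b else 0)
     + (transpose (Gamma A (B i)) ** (Q_bar (Q i) (P i) :: real^('t \<times> 'n)^('t \<times> 'n))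
          ** Gamma A (B j)) $ a $ b)"

definition q_vector ::
  "real^'n^'n \<Rightarrow> ('i::finite \<Rightarrow> real^'m^'n) \<Rightarrow> ('i \<Rightarrow> real^'n^'n) \<Rightarrow> ('i \<Rightarrow> real^'n^'n)
    \<Rightarrow> real^'n \<Rightarrow> real^('i \<times> 't::{finite,linorder} \<times> 'm::finite)" where
  "q_vector A B Q P x0 = (\<chi> r. case r of (i, a) \<Rightarrow>
     ((transpose (Gamma A (B i)) ** (Q_bar (Q i) (P i) :: real^('t \<times> 'n)^('t \<times> 'n))
          ** Theta A) *v x0) $ a)"

definition avi_solution :: "real^'k^'k \<Rightarrow> real^'k \<Rightarrow> (real^'k) set \<Rightarrow> real^'k \<Rightarrow> bool" where
  "avi_solution M q U u \<longleftrightarrow> u \<in> U \<and> (\<forall>v\<in>U. (M *v u + q) \<bullet> (v - u) \<ge> 0)"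

end

theory Submission
  imports Defs
begin

text \<open>Along the closed-loop trajectory \<open>x\<close>, the Riccati equation telescopes: \<open>P i x[s+1]\<close>
  is the sum over \<open>s \<le> t < T\<close> of \<open>transpose A ^ (t - s)\<close> times \<open>W x[t+1]\<close>, with weight \<open>W = P i\<close>
  at the last step and \<open>W = Q i\<close> before. Hence block \<open>(i, s)\<close> of \<open>M u_star + q\<close> is
  \<open>R i u_star i s + transpose (B i) P i x[s+1]\<close>, which vanishes by the definition of \<open>K i\<close>.
  Thus \<open>u_star\<close> is a zero of a strongly monotone affine map, and it is feasible because \<open>x0\<close>
  lies in the terminal set.\<close>

section \<open>Block matrices and matrix inverses\<close>

lemma sum_UNIV_prod:
  fixes f :: "'a::finite \<times> 'b::finite \<Rightarrow> 'c::comm_monoid_add"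
  shows "(\<Sum>p\<in>UNIV. f p) = (\<Sum>a\<in>UNIV. \<Sum>b\<in>UNIV. f (a, b))"
  by (simp add: sum.cartesian_product flip: UNIV_Times_UNIV)

text \<open>The stacked matrices are defined entrywise over product indices; with a suitable block
  family \<open>F\<close> they can be applied block by block. The outer index is a time for
  \<open>Gamma\<close>, \<open>Q_bar\<close> and \<open>R_bar\<close>, and an agent for
  \<open>M_matrix\<close>.\<close>

lemma block_matrix_vector_mult:
  fixes G :: "real^('s::finite \<times> 'l::finite)^('t::finite \<times> 'k::finite)" and F :: "'t \<Rightarrow> 's \<Rightarrow> real^'l^'k"
  assumes "\<And>t k s l. G $ (t, k) $ (s, l) = F t s $ k $ l"
  shows "(G *v w) $ (t, k) = (\<Sum>s\<in>UNIV. F t s *v (\<chi> l. w $ (s, l))) $ k"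
  by (simp add: matrix_vector_mult_def sum_UNIV_prod assms)

lemma matrix_vector_mult_sum_left:
  fixes F :: "'a \<Rightarrow> real^'n^'m"
  shows "(\<Sum>a\<in>S. F a) *v x = (\<Sum>a\<in>S. F a *v x)"
  by (induction S rule: infinite_finite_induct) (simp_all add: matrix_vector_mult_add_rdistrib)

lemma transpose_zero: "transpose (0 :: real^'n^'m) = 0"
  by (simp add: transpose_def vec_eq_iff)

lemma matrix_vector_mult_uminus_left: "(- M) *v x = - (M *v (x :: real^'n))"
  by (simp add: matrix_vector_mult_def vec_eq_iff sum_negf)

lemma pos_def_invertible:
  fixes R :: "real^'n^'n"
  assumes "pos_def R"
  shows "invertible R"
proof -
  have "x = 0" if "R *v x = 0" for x
    using assms that unfolding pos_def_def by (metis inner_zero_right less_irrefl)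
  then show ?thesis
    by (simp add: invertible_left_inverse matrix_left_invertible_ker)
qed

lemma matrix_mul_matrix_inv:
  fixes A :: "'a::semiring_1^'n^'m"
  assumes "invertible A"
  shows "A ** matrix_inv A = mat 1"
  using someI_ex[OF assms[unfolded invertible_def]] by (simp add: matrix_inv_def)

section \<open>Positions in the horizon\<close>

lemma pos_strict_mono: "s < t \<Longrightarrow> pos s < pos t"
  unfolding pos_def by (rule psubset_card_mono) auto

lemma pos_less_iff: "pos s < pos t \<longleftrightarrow> s < t"
  by (metis less_asym linorder_neqE pos_strict_mono)

lemma pos_le_iff: "pos s \<le> pos t \<longleftrightarrow> s \<le> t"
  by (simp add: pos_less_iff flip: not_less)

lemma pos_inj: "inj pos"
  by (metis injI order_antisym order_refl pos_le_iff)

lemma pos_less_card: "pos (t::'t::{finite,linorder}) < CARD('t)"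
  unfolding pos_def by (rule psubset_card_mono) auto

text \<open>An injection of \<open>'t\<close> into a set with \<open>CARD('t)\<close> elements is
  onto. This turns sums over \<open>'t\<close> into sums over natural numbers.\<close>

lemma range_pos: "range (pos :: 't::{finite,linorder} \<Rightarrow> nat) = {..<CARD('t)}"
  by (rule card_subset_eq) (auto simp: pos_less_card card_image[OF pos_inj])

text \<open>For the rows of \<open>Gamma\<close>: by causality, the state block \<open>t\<close>
  collects the inputs up to position \<open>t\<close>.\<close>

lemma sum_pos_upto:
  fixes t :: "'t::{finite,linorder}" and f :: "nat \<Rightarrow> 'a::comm_monoid_add"
  shows "(\<Sum>s\<in>UNIV. if s \<le> t then f (pos s) else 0) = (\<Sum>k\<le>pos t. f k)"
proof -
  have "(\<Sum>s\<in>UNIV. if s \<le> t then f (pos s) else 0)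
      = (\<Sum>s::'t\<in>UNIV. (\<lambda>k. if k \<le> pos t then f k else 0) (pos s))"
    by (simp add: pos_le_iff)
  also have "\<dots> = (\<Sum>k<CARD('t). if k \<le> pos t then f k else 0)"
    by (subst sum.reindex[OF pos_inj, unfolded o_def, symmetric]) (simp add: range_pos)
  also have "\<dots> = (\<Sum>k\<le>pos t. f k)"
    using pos_less_card[of t] by (intro sum.mono_neutral_cong_right) auto
  finally show ?thesis .
qed

text \<open>For the columns of \<open>Gamma\<close>: the input at \<open>s\<close> influences the
  state blocks from \<open>s\<close> on.\<close>

lemma sum_pos_from:
  fixes s :: "'t::{finite,linorder}" and f :: "nat \<Rightarrow> 'a::comm_monoid_add"
  shows "(\<Sum>t\<in>UNIV. if s \<le> t then f (pos t) else 0) = (\<Sum>k=pos s..<CARD('t). f k)"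
proof -
  have "(\<Sum>t\<in>UNIV. if s \<le> t then f (pos t) else 0)
      = (\<Sum>t::'t\<in>UNIV. (\<lambda>k. if pos s \<le> k then f k else 0) (pos t))"
    by (simp add: pos_le_iff)
  also have "\<dots> = (\<Sum>k<CARD('t). if pos s \<le> k then f k else 0)"
    by (subst sum.reindex[OF pos_inj, unfolded o_def, symmetric]) (simp add: range_pos)
  also have "\<dots> = (\<Sum>k=pos s..<CARD('t). f k)"
    by (intro sum.mono_neutral_cong_right) auto
  finally show ?thesis .
qed

section \<open>Prediction matrices and stacked trajectories\<close>

text \<open>Variation of constants: the input at time \<open>s\<close> enters the state at
  \<open>s + 1\<close> and is then propagated through \<open>t - 1 - s\<close> further
  steps.\<close>

lemma state_eq:
  "state A B t x0 u = matpow A t *v x0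
     + (\<Sum>i\<in>UNIV. \<Sum>s<t. (matpow A (t - 1 - s) ** B i) *v u i s)"
proof (induction t)
  case 0
  then show ?case by simp
next
  case (Suc t)
  \<comment> \<open>Subtraction truncates at zero, so absorbing a factor \<open>A\<close> into the
    power needs \<open>s < t\<close>; the congruence rule below provides this bound inside the
    sum.\<close>
  have *: "A ** (matpow A (t - Suc s) ** B i) = matpow A (t - s) ** B i" if "s < t" for s i
  proof -
    have "t - s = Suc (t - Suc s)"
      using that by simp
    then show ?thesis
      by (simp add: matrix_mul_assoc)
  qed
  show ?case
    by (simp add: Suc.IH matrix_vector_right_distrib vec.sum * sum.distrib
        matrix_vector_mul_assoc add.assoc cong: sum.cong_simp)
qed

text \<open>This is \<open>state_eq\<close> at time \<open>pos t + 1\<close>: the stacked states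
  begin with x[1], whereas the stacked inputs begin at time 0.\<close>

lemma Theta_Gamma_component:
  fixes A :: "real^'n^'n" and B :: "'i::finite \<Rightarrow> real^'m^'n" and t :: "'t::{finite,linorder}"
  shows "(Theta A *v x0 + (\<Sum>i\<in>UNIV. Gamma A (B i) *v (\<chi> a. stack u $ (i, a)))) $ (t, k)
    = state A B (Suc (pos t)) x0 u $ k"
proof -
  have Theta: "(Theta A *v x0) $ (t, k) = (matpow A (Suc (pos t)) *v x0) $ k"
    by (simp add: Theta_def matrix_vector_mult_def)
  have Gamma: "(Gamma A (B i) *v (\<chi> a. stack u $ (i, a))) $ (t, k)
      = (\<Sum>s<Suc (pos t). (matpow A (pos t - s) ** B i) *v u i s) $ k" for i
  proof -
    have "(Gamma A (B i) *v (\<chi> a. stack u $ (i, a))) $ (t, k)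
        = (\<Sum>s\<in>UNIV. (if s \<le> t then matpow A (pos t - pos s) ** B i else 0) *v u i (pos s)) $ k"
      by (subst block_matrix_vector_mult[where
            F="\<lambda>t s. if s \<le> t then matpow A (pos t - pos s) ** B i else 0"])
        (simp_all add: Gamma_def stack_def)
    also have "\<dots> = (\<Sum>s\<in>UNIV. if s \<le> t then (matpow A (pos t - pos s) ** B i) *v u i (pos s) else 0) $ k"
      by (rule arg_cong[where f="\<lambda>v. v $ k"], rule sum.cong) auto
    also have "\<dots> = (\<Sum>s<Suc (pos t). (matpow A (pos t - s) ** B i) *v u i s) $ k"
      by (subst sum_pos_upto) (simp add: lessThan_Suc_atMost)
    finally show ?thesis .
  qed
  show ?thesis
    by (simp add: state_eq Theta Gamma del: state.simps matpow.simps sum.lessThan_Suc)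
qed

section \<open>The affine map of the variational inequality\<close>

text \<open>The transpose of \<open>Gamma\<close> runs the dynamics backwards: the weighted states
  at positions \<open>t\<close> from \<open>s\<close> on are pulled back to \<open>s\<close> by
  powers of \<open>transpose A\<close>, as in a costate recursion.\<close>

lemma transpose_Gamma_Q_bar:
  fixes A :: "real^'n^'n" and B :: "real^'m^'n" and s :: "'t::{finite,linorder}"
    and w :: "real^('t \<times> 'n::finite)"
  assumes w: "\<And>t k. w $ (t, k) = y (pos t) $ k"
  shows "(transpose (Gamma A B) *v (Q_bar Q P *v w)) $ (s, l)
    = (transpose B *v (\<Sum>t=pos s..<CARD('t). transpose (matpow A (t - pos s)) *v
          ((if t + 1 = CARD('t) then P else Q) *v y t))) $ l"
proof -
  let ?W = "\<lambda>t. if t + 1 = CARD('t) then P else Q"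
  have "(Q_bar Q P *v w) $ (t, k) = (?W (pos t) *v y (pos t)) $ k" for t k
  proof -
    have "(Q_bar Q P *v w) $ (t, k)
        = (\<Sum>s\<in>UNIV. (if t = s then ?W (pos t) else 0) *v y (pos s)) $ k"
      by (subst block_matrix_vector_mult[where F="\<lambda>t s. if t = s then ?W (pos t) else 0"])
        (simp_all add: Q_bar_def w)
    also have "(\<Sum>s\<in>UNIV. (if t = s then ?W (pos t) else 0) *v y (pos s))
        = (\<Sum>s\<in>UNIV. if t = s then ?W (pos t) *v y (pos s) else 0)"
      by (rule sum.cong) auto
    finally show ?thesis by simp
  qed
  then have Q_bar: "(\<chi> k. (Q_bar Q P *v w) $ (t, k)) = ?W (pos t) *v y (pos t)" for t
    by (simp add: vec_eq_iff)
  have "(transpose (Gamma A B) *v (Q_bar Q P *v w)) $ (s, l)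
      = (\<Sum>t\<in>UNIV. transpose (if s \<le> t then matpow A (pos t - pos s) ** B else 0) *v
           (?W (pos t) *v y (pos t))) $ l"
    by (subst block_matrix_vector_mult[where
          F="\<lambda>s t. transpose (if s \<le> t then matpow A (pos t - pos s) ** B else 0)"])
      (simp_all add: Gamma_def transpose_def Q_bar)
  also have "\<dots> = (\<Sum>t\<in>UNIV. if s \<le> t then transpose B *v
      (transpose (matpow A (pos t - pos s)) *v (?W (pos t) *v y (pos t))) else 0) $ l"
    by (rule arg_cong[where f="\<lambda>v. v $ l"], rule sum.cong)
      (auto simp: matrix_transpose_mul transpose_zero simp del: transpose_matrix_vector
        simp flip: matrix_vector_mul_assoc)
  also have "\<dots> = (transpose B *v (\<Sum>t=pos s..<CARD('t).
      transpose (matpow A (t - pos s)) *v (?W t *v y t))) $ l"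
    by (subst sum_pos_from[where f="\<lambda>t. transpose B *v
          (transpose (matpow A (t - pos s)) *v (?W t *v y t))"])
      (simp add: vec.sum)
  finally show ?thesis .
qed

lemma R_bar_component:
  fixes s :: "'t::{finite,linorder}"
  shows "(R_bar R *v (\<chi> a. stack u $ (i, a))) $ (s, l) = (R *v u i (pos s)) $ l"
proof -
  have "(R_bar R *v (\<chi> a. stack u $ (i, a))) $ (s, l)
      = (\<Sum>t\<in>UNIV. (if s = t then R else 0) *v u i (pos t)) $ l"
    by (subst block_matrix_vector_mult[where F="\<lambda>s t. if s = t then R else 0"])
      (simp_all add: R_bar_def stack_def)
  also have "(\<Sum>t\<in>UNIV. (if s = t then R else 0) *v u i (pos t))
      = (\<Sum>t\<in>UNIV. if s = t then R *v u i (pos t) else 0)"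
    by (rule sum.cong) auto
  finally show ?thesis by simp
qed

text \<open>The vector \<open>q\<close> carries the free response \<open>Theta A *v x0\<close> and
  \<open>M\<close> the response to the inputs, so together they apply \<open>Q_bar\<close> to the
  whole trajectory. What results is the derivative of the cost of agent \<open>i\<close>, with
  terminal weight \<open>P i\<close>, when \<open>P i\<close> and \<open>Q i\<close> are read as
  symmetric weights.\<close>

lemma M_matrix_q_vector_component:
  fixes A :: "real^'n^'n" and B :: "'i::finite \<Rightarrow> real^'m^'n" and s :: "'t::{finite,linorder}"
  shows "(M_matrix A B Q R P *v stack u + q_vector A B Q P x0) $ (i, s, l)
    = (R i *v u i (pos s) + transpose (B i) *v
        (\<Sum>t=pos s..<CARD('t). transpose (matpow A (t - pos s)) *v
          ((if t + 1 = CARD('t) then P i else Q i) *v state A B (Suc t) x0 u))) $ l"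
proof -
  let ?u = "\<lambda>j. (\<chi> a. stack u $ (j, a)) :: real^('t \<times> 'm)"
  let ?G = "\<lambda>j. Gamma A (B j) :: real^('t \<times> 'm)^('t \<times> 'n)"
  let ?Qb = "Q_bar (Q i) (P i) :: real^('t \<times> 'n)^('t \<times> 'n)"
  let ?X = "Theta A *v x0 + (\<Sum>j\<in>UNIV. ?G j *v ?u j)"
  have "(M_matrix A B Q R P *v stack u) $ (i, s, l)
      = (\<Sum>j\<in>UNIV. ((if i = j then R_bar (R i) else 0) + transpose (?G i) ** ?Qb ** ?G j) *v ?u j) $ (s, l)"
    by (subst block_matrix_vector_mult[where F="\<lambda>i j. (if i = j then R_bar (R i) else 0)
            + transpose (?G i) ** (Q_bar (Q i) (P i) :: real^('t \<times> 'n)^('t \<times> 'n)) ** ?G j"])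
      (simp_all add: M_matrix_def)
  also have "(\<Sum>j\<in>UNIV. ((if i = j then R_bar (R i) else 0) + transpose (?G i) ** ?Qb ** ?G j) *v ?u j)
      = (\<Sum>j\<in>UNIV. (if i = j then R_bar (R i) *v ?u j else 0)
          + transpose (?G i) *v (?Qb *v (?G j *v ?u j)))"
    by (rule sum.cong) (auto simp: matrix_vector_mult_add_rdistrib matrix_vector_mul_assoc matrix_mul_assoc)
  also have "\<dots> = R_bar (R i) *v ?u i + transpose (?G i) *v (?Qb *v (\<Sum>j\<in>UNIV. ?G j *v ?u j))"
    by (simp add: sum.distrib vec.sum)
  finally have "(M_matrix A B Q R P *v stack u + q_vector A B Q P x0) $ (i, s, l)
      = (R_bar (R i) *v ?u i + transpose (?G i) *v (?Qb *v ?X)) $ (s, l)"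
    by (simp add: q_vector_def matrix_vector_right_distrib matrix_vector_mul_assoc matrix_mul_assoc)
  moreover have "(transpose (?G i) *v (?Qb *v ?X)) $ (s, l)
      = (transpose (B i) *v (\<Sum>t=pos s..<CARD('t). transpose (matpow A (t - pos s)) *v
          ((if t + 1 = CARD('t) then P i else Q i) *v state A B (Suc t) x0 u))) $ l"
    \<comment> \<open>Here \<open>w\<close> is the stacked trajectory \<open>?X\<close>, and
      \<open>y t\<close> is the state at time \<open>Suc t\<close>.\<close>
    by (rule transpose_Gamma_Q_bar) (rule Theta_Gamma_component)
  ultimately show ?thesis
    by (simp only: vector_add_component R_bar_component)
qed

section \<open>Riccati equation and closed-loop inputs\<close>

text \<open>The assumption is the Riccati equation evaluated along a closed-loop trajectory
  \<open>y\<close>. Expanding \<open>P *v y s\<close> by it repeatedly leaves a remainder with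
  weight \<open>P\<close>, which is exactly the terminal term.\<close>

lemma riccati_telescope:
  fixes A :: "real^'n^'n"
  assumes "\<And>k. P *v y k = Q *v y k + transpose A *v (P *v y (Suc k))" and "s < T"
  shows "(\<Sum>t=s..<T. transpose (matpow A (t - s)) *v ((if t + 1 = T then P else Q) *v y t))
    = P *v y s"
proof -
  have partial: "(\<Sum>k<d. transpose (matpow A k) *v (Q *v y (s + k)))
      + transpose (matpow A d) *v (P *v y (s + d)) = P *v y s" for d
  proof (induction d)
    case 0
    then show ?case by simp
  next
    case (Suc d)
    have "transpose (matpow A d) *v (P *v y (s + d))
        = transpose (matpow A d) *v (Q *v y (s + d))
          + transpose (matpow A (Suc d)) *v (P *v y (s + Suc d))"
      by (subst assms(1))
        (simp add: matrix_vector_right_distrib matrix_transpose_mul matrix_vector_mul_assoc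
          matrix_mul_assoc)
    with Suc.IH show ?case
      by (simp add: add.assoc)
  qed
  \<comment> \<open>There are \<open>d + 1\<close> terms from \<open>s\<close> to
    \<open>T - 1\<close>: the first \<open>d\<close> have weight \<open>Q\<close>, and the last has
    weight \<open>P\<close>.\<close>
  obtain d where d: "T = s + Suc d"
    using \<open>s < T\<close> less_imp_Suc_add by auto
  have "(\<Sum>t=s..<T. transpose (matpow A (t - s)) *v ((if t + 1 = T then P else Q) *v y t))
      = (\<Sum>k<Suc d. transpose (matpow A k) *v ((if k = d then P else Q) *v y (s + k)))"
    by (rule sum.reindex_bij_witness[where i="\<lambda>k. s + k" and j="\<lambda>t. t - s"]) (auto simp: d)
  also have "\<dots> = P *v y s"
    by (subst partial[of d, symmetric])
      (simp del: transpose_matrix_vector cong: sum.cong_simp)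
  finally show ?thesis .
qed

lemma matpow_Suc_vector: "matpow A (Suc t) *v x = A *v (matpow A t *v (x :: real^'n))"
  by (simp add: matrix_vector_mul_assoc)

lemma closed_loop_vector:
  "closed_loop A B K *v x = A *v x + (\<Sum>i\<in>UNIV. B i *v (K i *v x))"
  by (simp add: closed_loop_def matrix_vector_mult_add_rdistrib matrix_vector_mult_sum_left
      matrix_vector_mul_assoc)

text \<open>The sequence \<open>u\<close> is open loop, given by powers of the closed-loop matrix
  and not by the current state; by induction it generates the closed-loop trajectory.\<close>

lemma state_feedback:
  assumes "\<And>i t. u i t = K i *v (matpow (closed_loop A B K) t *v x0)"
  shows "state A B t x0 u = matpow (closed_loop A B K) t *v x0"
proof (induction t)
  case 0
  then show ?case by simp
next
  case (Suc t)
  show ?case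
    unfolding matpow_Suc_vector closed_loop_vector state.simps Suc.IH by (simp only: assms)
qed

text \<open>Forward invariance keeps the trajectory in \<open>Xf\<close>, where the state
  constraints and, under the feedback, the coupled input constraints hold.\<close>

lemma feedback_feasible:
  assumes Xf: "terminal_set A B K Dx dx Du du Xf" and "x0 \<in> Xf"
    and u: "\<And>i t. u i t = K i *v (matpow (closed_loop A B K) t *v x0)"
  shows "u \<in> feasible_inputs A B Dx dx Du du T x0"
proof -
  have "matpow (closed_loop A B K) t *v x0 \<in> Xf" for t
    by (induction t) (use assms in \<open>auto simp: terminal_set_def matpow_Suc_vector
        simp del: matpow.simps(2)\<close>)
  then have "state A B t x0 u \<in> state_constr Dx dx"
    and "(\<Sum>j\<in>UNIV. Du j *v u j t) + du \<le> 0" for t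
    using Xf unfolding state_feedback[OF u] u terminal_set_def by blast+
  \<comment> \<open>Overwriting an agent's input by itself changes nothing, so the constraints of
    all agents at time \<open>t\<close> reduce to the same coupled inequality.\<close>
  moreover have "(\<lambda>j. u j t)(i := u i t) = (\<lambda>j. u j t)" for i t
    by auto
  ultimately show ?thesis
    by (simp add: feasible_inputs_def input_constr_def del: fun_upd_apply)
qed

lemma feedback_zero:
  fixes A :: "real^'n^'n" and B :: "'i::finite \<Rightarrow> real^'m^'n"
  assumes R: "\<And>i. invertible (R i)" and riccati: "coupled_riccati A B Q R P K"
    and u: "\<And>i t. u i t = K i *v (matpow (closed_loop A B K) t *v x0)"
  shows "M_matrix A B Q R P *v stack u + q_vector A B Q P x0
    = (0 :: real^('i \<times> 't::{finite,linorder} \<times> 'm))"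
proof -
  let ?x = "\<lambda>t. matpow (closed_loop A B K) t *v x0"
  have x: "state A B t x0 u = ?x t" for t
    by (rule state_feedback) (rule u)
  have P: "P i *v ?x t = Q i *v ?x t + transpose A *v (P i *v ?x (Suc t))" for i t
  proof -
    have "P i *v ?x t = (Q i + transpose A ** P i ** closed_loop A B K) *v ?x t"
      using riccati unfolding coupled_riccati_def by metis
    then show ?thesis
      by (simp only: matrix_vector_mult_add_rdistrib matpow_Suc_vector flip: matrix_vector_mul_assoc)
  qed
  \<comment> \<open>Multiplying the gain formula by \<open>R i\<close> cancels its inverse and gives
    the stationarity condition of agent \<open>i\<close>.\<close>
  have K: "R i *v u i t = - (transpose (B i) *v (P i *v ?x (Suc t)))" for i t
  proof -
    have "R i *v u i t = R i *v (- (matrix_inv (R i) ** transpose (B i) ** P i ** closed_loop A B K) *v ?x t)"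
      using riccati unfolding coupled_riccati_def u by metis
    also have "\<dots> = - ((R i ** matrix_inv (R i)) *v (transpose (B i) *v (P i *v ?x (Suc t))))"
      by (simp only: matrix_vector_mult_uminus_left vec.neg matpow_Suc_vector
          flip: matrix_vector_mul_assoc)
    finally show ?thesis
      by (simp add: matrix_mul_matrix_inv[OF R])
  qed
  have "(M_matrix A B Q R P *v stack u + q_vector A B Q P x0) $ (i, s, l) = 0"
    for i and s :: 't and l
  proof -
    have "(\<Sum>t=pos s..<CARD('t). transpose (matpow A (t - pos s)) *v
          ((if t + 1 = CARD('t) then P i else Q i) *v ?x (Suc t))) = P i *v ?x (Suc (pos s))"
      \<comment> \<open>The trajectory is shifted by one step, so the sum collapses to
        \<open>P i\<close> times the state at \<open>Suc (pos s)\<close>, the very term that occurs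
        in \<open>K\<close>.\<close>
      by (rule riccati_telescope[where y="\<lambda>t. ?x (Suc t)"]) (rule P, rule pos_less_card)
    then show ?thesis
      unfolding M_matrix_q_vector_component x K by simp
  qed
  then show ?thesis
    by (simp add: vec_eq_iff)
qed

section \<open>Uniqueness by strong monotonicity\<close>

text \<open>At a zero of the affine map every inner product in the inequality vanishes. Testing any
  other solution \<open>u\<close> against \<open>z\<close> bounds a positive definite form at
  \<open>u - z\<close> above by zero.\<close>

lemma avi_solution_zero_unique:
  fixes M :: "real^'k^'k"
  assumes pd: "pos_def (M + transpose M)" and "z \<in> U" and z: "M *v z + q = 0"
  shows "avi_solution M q U z \<and> (\<forall>u. avi_solution M q U u \<longrightarrow> u = z)"
proof (intro conjI allI impI)
  show "avi_solution M q U z"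
    using assms by (simp add: avi_solution_def)
next
  fix u assume "avi_solution M q U u"
  then have "(M *v u + q) \<bullet> (z - u) \<ge> 0"
    using \<open>z \<in> U\<close> by (simp add: avi_solution_def)
  moreover have "M *v u + q = M *v (u - z)"
    using z by (simp add: matrix_vector_mult_diff_distrib add_eq_0_iff)
  moreover have "(M *v (u - z)) \<bullet> (z - u) = - ((u - z) \<bullet> (M *v (u - z)))"
    by (metis inner_commute inner_minus_left minus_diff_eq)
  ultimately have "(u - z) \<bullet> (M *v (u - z)) \<le> 0"
    by simp
  \<comment> \<open>A quadratic form sees only the symmetric part of its matrix, so \<open>M\<close>
    itself may be nonsymmetric.\<close>
  moreover have "(u - z) \<bullet> ((M + transpose M) *v (u - z)) = 2 * ((u - z) \<bullet> (M *v (u - z)))"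
    by (simp add: matrix_vector_mult_add_rdistrib inner_add_right inner_commute
        flip: dot_lmul_matrix)
  ultimately have "\<not> (u - z) \<bullet> ((M + transpose M) *v (u - z)) > 0"
    by simp
  then show "u = z"
    using pd unfolding pos_def_def by (metis right_minus_eq)
qed

theorem proposition1:
  fixes A :: "real^'n^'n" and B :: "'i::finite \<Rightarrow> real^'m^'n"
    and C :: "'i \<Rightarrow> real^'n^'p"
    and Q P :: "'i \<Rightarrow> real^'n^'n" and R :: "'i \<Rightarrow> real^'m^'m"
    and K :: "'i \<Rightarrow> real^'n^'m"
    and Dx :: "real^'n^'r" and dx :: "real^'r"
    and Du :: "'i \<Rightarrow> real^'m^'s" and du :: "real^'s"
    and Xf :: "(real^'n) set" and x0 :: "real^'n" and T :: nat
    and M :: "real^('i \<times> 't \<times> 'm)^('i \<times> 't::{finite,linorder} \<times> 'm::finite)"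
    and q :: "real^('i \<times> 't \<times> 'm)"
    and U :: "(real^('i \<times> 't \<times> 'm)) set"
    and u_star :: "'i \<Rightarrow> nat \<Rightarrow> real^'m"
  assumes Q: "\<And>i. Q i = transpose (C i) ** C i"
    and R: "\<And>i. pos_def (R i)"
    and stabilizable: "\<And>i. stabilizable A (B i)"
    and detectable: "\<And>i. detectable A (C i)"
    and state_interior: "0 \<in> interior (state_constr Dx dx)"
    and input_interior: "\<And>i. 0 \<in> interior (input_constr Du du i (\<lambda>_. 0))"
    and A_invertible: "invertible A"
    and H: "H_condition A B Q R"
    and riccati: "coupled_riccati A B Q R P K"
    and stable: "schur_stable (closed_loop A B K)"
    and Xf: "terminal_set A B K Dx dx Du du Xf"
    and T: "T = CARD('t)"
    and M: "M = M_matrix A B Q R P"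
    and q: "q = q_vector A B Q P x0"
    and U: "U = stack ` feasible_inputs A B Dx dx Du du T x0"
    and x0: "x0 \<in> Xf"
    and M_pos_def: "pos_def (M + transpose M)"
    and u_star: "\<And>i t. u_star i t = K i *v (matpow (closed_loop A B K) t *v x0)"
  shows "avi_solution M q U (stack u_star) \<and>
         (\<forall>u. avi_solution M q U u \<longrightarrow> u = stack u_star)"
proof -
  have "stack u_star \<in> U"
    unfolding U using feedback_feasible[OF Xf x0 u_star] by blast
  moreover have "M *v stack u_star + q = 0"
    unfolding M q using feedback_zero[OF pos_def_invertible[OF R] riccati u_star] .
  ultimately show ?thesis
    by (rule avi_solution_zero_unique[OF M_pos_def])
qed

end
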